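(* Let $F \in \mathbb{R}^{n\times n}$. There exists a matrix $H \in \mathbb{R}^{n\times n}$ with $\operatorname{rank}(H)=1$ and a real number $\alpha_1<0$ such that the stability region of $F+\alpha H$ with respect to the real parameter $\alpha$ contains the interval $(-\infty,\alpha_1]$, i.e. $F+\alpha H$ is Hurwitz stable for every $\alpha \le \alpha_1$, if and only if every unstable eigenvalue of $F$ corresponds to only one Jordan block in the Jordan canonical form of $F$.
   Context: A square real matrix is called (Hurwitz) stable if all its eigenvalues have strictly negative real part. The stability region of $F+\alpha H$ with respect to $\alpha$ is the set of $\alpha\in\mathbb{R}$ for which $F+\alpha H$ is stable. An unstable eigenvalue of $F$ is an eigenvalue $\lambda$ (over $\mathbb{C}$) with $\operatorname{Re}\lambda \ge 0$; "corresponds to only one Jordan block" means that $\lambda$ appears in exactly one Jordan block of the (complex) Jordan canonical form of $F$, i.e. its geometric multiplicity is $1$. *)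

theory Defs
  imports
    "Jordan_Normal_Form.Jordan_Normal_Form_Existence"
    "Jordan_Normal_Form.Jordan_Normal_Form_Uniqueness"
    "Jordan_Normal_Form.DL_Rank"
begin

abbreviation cmat :: "real mat \<Rightarrow> complex mat" where
  "cmat A \<equiv> map_mat complex_of_real A"

definition hurwitz_stable :: "real mat \<Rightarrow> bool" where
  "hurwitz_stable A \<longleftrightarrow> (\<forall>z. eigenvalue (cmat A) z \<longrightarrow> Re z < 0)"

definition stability_region :: "real mat \<Rightarrow> real mat \<Rightarrow> real set" where
  "stability_region F H = {\<alpha>. hurwitz_stable (F + \<alpha> \<cdot>\<^sub>m H)}"

definition unstable_eigenvalue :: "real mat \<Rightarrow> complex \<Rightarrow> bool" where
  "unstable_eigenvalue F z \<longleftrightarrow> eigenvalue (cmat F) z \<and> Re z \<ge> 0"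

text \<open>
  A list \<open>bs\<close> with \<open>jordan_nf A bs\<close> holds one pair \<open>(k, a)\<close>, of size and eigenvalue, for each
  block of a Jordan form of \<open>A\<close>. Equal blocks are repeated, so blocks are counted in the list
  and not in its set. The choice of \<open>bs\<close> is immaterial by \<open>only_one_jordan_block_iff\<close> below.
\<close>

definition only_one_jordan_block :: "complex mat \<Rightarrow> complex \<Rightarrow> bool" where
  "only_one_jordan_block A z \<longleftrightarrow>
     (\<exists>bs. jordan_nf A bs \<and> length (filter (\<lambda>(k, a). a = z) bs) = 1)"

lemma length_filter_jordan_nf:
  assumes "jordan_nf (A :: complex mat) bs"
  shows "length (filter (\<lambda>(k, a). a = z) bs) = dim_gen_eigenspace A z 1"
proof -
  have "0 \<notin> fst ` set bs \<Longrightarrow> length (filter (\<lambda>(k, a). a = z) bs) =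
      (\<Sum>k\<leftarrow>map fst (filter (\<lambda>(k, a). a = z) bs). min 1 k)"
    by (induction bs) auto
  moreover have "(\<lambda>(k :: nat, a). a = z) = (\<lambda>(k, a). z = a)"
    by auto
  ultimately show ?thesis
    using assms by (auto simp: dim_gen_eigenspace[OF assms] jordan_nf_def)
qed

lemma only_one_jordan_block_iff:
  assumes "jordan_nf A bs"
  shows "only_one_jordan_block A z \<longleftrightarrow> length (filter (\<lambda>(k, a). a = z) bs) = 1"
  using assms length_filter_jordan_nf unfolding only_one_jordan_block_def by metis

end

theory Submission
  imports Defs "Jordan_Normal_Form.Spectral_Radius"
begin

text \<open>
  Write \<open>H = b c\<^sup>T\<close>. If \<open>F + \<alpha> H\<close> is stable, then \<open>c\<close> is nonzero on every eigenvector of an unstable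
  eigenvalue \<open>z\<close>, since an eigenvector killed by \<open>c\<close> survives the perturbation. A functional that is
  nonzero on every nonzero vector of the eigenspace forces that eigenspace to be one-dimensional.

  Conversely, one-dimensional unstable eigenspaces are finitely many lines, so some real \<open>c\<close> vanishes
  on none of them. Let \<open>\<mu>\<close>, of degree \<open>m\<close>, be the minimal polynomial of the row \<open>c\<^sup>T\<close> under \<open>F\<close>.
  If \<open>(F - k b c\<^sup>T) v = z v\<close>, applying the rows \<open>c\<^sup>T F^j\<close> and summing with the coefficients of \<open>\<mu>\<close>
  gives \<open>(c\<^sup>T v) (\<mu>(z) + k q(z)) = 0\<close>, where \<open>q\<close> depends only on the values \<open>c\<^sup>T F^j b\<close> for \<open>j < m\<close>.
  These can be prescribed so that \<open>q(z) = (z + 1)^(m - 1)\<close>, and then \<open>\<mu> + k q\<close> has no root in the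
  closed right half-plane for large \<open>k\<close>, because \<open>\<mu>(z) = (z + 1) q(z) + O(|q(z)|)\<close> there. So
  \<open>Re z \<ge> 0\<close> would force \<open>c\<^sup>T v = 0\<close>, which makes \<open>v\<close> an unstable eigenvector of \<open>F\<close>
  and contradicts the choice of \<open>c\<close>.
\<close>

section \<open>One-dimensional spaces\<close>

lemma (in vectorspace) dim_1_multiples:
  assumes "fin_dim" and "dim = 1"
  obtains w where "w \<in> carrier V"
    and "\<And>u. u \<in> carrier V \<Longrightarrow> \<exists>a\<in>carrier K. u = a \<odot>\<^bsub>V\<^esub> w"
proof -
  obtain B where B: "finite B" "basis B"
    using finite_basis_exists[OF assms(1)] by blast
  then have "card B = 1"
    using dim_basis assms(2) by simp
  then obtain w where Bw: "B = {w}"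
    by (auto simp: card_1_singleton_iff)
  have w: "w \<in> carrier V" and gen: "span {w} = carrier V"
    using B(2) unfolding basis_def Bw by auto
  have "\<exists>a\<in>carrier K. u = a \<odot>\<^bsub>V\<^esub> w" if "u \<in> carrier V" for u
  proof -
    have "u \<in> span {w}"
      using that gen by simp
    then obtain a where "a \<in> {w} \<rightarrow> carrier K" "u = lincomb a {w}"
      using finite_span[of "{w}"] w by auto
    then show ?thesis
      using w by (auto simp: lincomb_def)
  qed
  with w show ?thesis
    using that by blast
qed

lemma (in vectorspace) dim_1_if_multiples:
  assumes "w \<in> carrier V" and "w \<noteq> \<zero>\<^bsub>V\<^esub>"
    and "\<And>u. u \<in> carrier V \<Longrightarrow> \<exists>a\<in>carrier K. u = a \<odot>\<^bsub>V\<^esub> w"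
  shows "dim = 1"
proof (rule dim1I[OF _ assms(2,1)])
  have "u \<in> span {w}" if u: "u \<in> carrier V" for u
  proof -
    obtain a where a: "a \<in> carrier K" "u = a \<odot>\<^bsub>V\<^esub> w"
      using assms(3)[OF u] by blast
    then have "u = lincomb (\<lambda>_. a) {w}"
      using assms(1) by (simp add: lincomb_def)
    then show ?thesis
      using a(1) finite_span[of "{w}"] assms(1) by auto
  qed
  then show "span {w} = carrier V"
    using span_is_subset2[of "{w}"] assms(1) by auto
qed

lemma (in vectorspace) lin_indpt_singleton:
  assumes "v \<in> carrier V" and "v \<noteq> \<zero>\<^bsub>V\<^esub>"
  shows "lin_indpt {v}"
  using assms by (metis empty_iff empty_subsetI finite.emptyI finite_lin_indpt2 insert_union
      lin_dep_iff_in_span span_empty singletonD)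

lemma (in kernel) fin_dim_kernel: "Ker.fin_dim"
  using kernel_basis_exists[OF A] unfolding Ker.fin_dim_def Ker.basis_def by blast

text \<open>The blocks of \<open>z\<close> number the dimension of the kernel of
  \<open>char_matrix A z\<close>. Trading this dimension for multiples of one eigenvector lets the
  later arguments run in coordinates.\<close>

lemma only_one_jordan_block_iff_multiples:
  assumes "A \<in> carrier_mat n n"
  shows "only_one_jordan_block A z \<longleftrightarrow>
    (\<exists>v. eigenvector A v z \<and> (\<forall>u. eigenvector A u z \<longrightarrow> (\<exists>a. u = a \<cdot>\<^sub>v v)))"
proof -
  let ?C = "char_matrix A z"
  have C: "?C \<in> carrier_mat n n"
    using assms by simp
  interpret kernel n n ?C
    by unfold_locales (rule C)
  obtain bs where "jordan_nf A bs"
    using jordan_nf_exists[OF assms] char_poly_factorized[OF assms] by blast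
  then have block: "only_one_jordan_block A z \<longleftrightarrow> dim = 1"
    using only_one_jordan_block_iff[of A bs z] length_filter_jordan_nf[of A bs z]
      kernel_dim C unfolding dim_gen_eigenspace_def by simp
  have ev: "eigenvector A v z \<longleftrightarrow> v \<in> mat_kernel ?C \<and> v \<noteq> 0\<^sub>v n" for v
    using eigenvector_char_matrix[OF assms] mat_kernel[OF C] by auto
  show ?thesis
    unfolding block
  proof
    assume dim: "dim = 1"
    obtain w where w: "w \<in> mat_kernel ?C"
      and mult: "\<And>u. u \<in> mat_kernel ?C \<Longrightarrow> \<exists>a. u = a \<cdot>\<^sub>v w"
      using Ker.dim_1_multiples[OF fin_dim_kernel dim] by auto
    \<comment> \<open>Otherwise the kernel is trivial and generated by the empty set, so its
      dimension is 0.\<close>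
    have "w \<noteq> 0\<^sub>v n"
    proof
      assume w0: "w = 0\<^sub>v n"
      have "mat_kernel ?C \<subseteq> {0\<^sub>v n}"
        using mult w0 by force
      then have "Ker.gen_set {}"
        using w w0 Ker.span_empty by auto
      then have "Ker.dim \<le> card {}"
        using Ker.gen_ge_dim[of "{}"] by simp
      then show False
        using dim by simp
    qed
    then show "\<exists>v. eigenvector A v z \<and> (\<forall>u. eigenvector A u z \<longrightarrow> (\<exists>a. u = a \<cdot>\<^sub>v v))"
      using w mult ev by blast
  next
    assume "\<exists>v. eigenvector A v z \<and> (\<forall>u. eigenvector A u z \<longrightarrow> (\<exists>a. u = a \<cdot>\<^sub>v v))"
    then obtain v where v: "v \<in> mat_kernel ?C" "v \<noteq> 0\<^sub>v n"
      and mult: "\<And>u. u \<in> mat_kernel ?C \<Longrightarrow> u \<noteq> 0\<^sub>v n \<Longrightarrow> \<exists>a. u = a \<cdot>\<^sub>v v"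
      using ev by blast
    have "0\<^sub>v n = 0 \<cdot>\<^sub>v v"
      using mat_kernelD(1)[OF C v(1)] by auto
    then have "\<exists>a. u = a \<cdot>\<^sub>v v" if "u \<in> mat_kernel ?C" for u
      using mult[OF that] by blast
    then show "dim = 1"
      using Ker.dim_1_if_multiples[of v] v by auto
  qed
qed

section \<open>Rank-one matrices as a column times a row\<close>

lemma rank_1_product_entries:
  assumes H: "H \<in> carrier_mat n m" and rank: "vec_space.rank n (H :: 'a :: field mat) = 1"
  obtains b c where "\<And>i j. i < n \<Longrightarrow> j < m \<Longrightarrow> H $$ (i, j) = b i * c j"
proof -
  interpret vec_space "TYPE('a)" n .
  have cols: "set (cols H) \<subseteq> carrier_vec n"
    using H cols_dim by blast
  let ?W = "span_vs (set (cols H))"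
  interpret W: vectorspace class_ring ?W
    using span_is_subspace[THEN subspace_is_vs] cols by auto
  obtain w where "w \<in> carrier ?W"
    and mult: "\<And>u. u \<in> carrier ?W \<Longrightarrow> \<exists>a\<in>carrier class_ring. u = a \<odot>\<^bsub>?W\<^esub> w"
    using W.dim_1_multiples[OF fin_dim_span_cols[OF H]] rank unfolding rank_def by blast
  then have w: "w \<in> carrier_vec n"
    using span_is_subset2 cols by auto
  \<comment> \<open>Each column lies in the column space, a line through \<open>w\<close>; the
    factors form the row \<open>c\<close>.\<close>
  have "\<exists>a. col H j = a \<cdot>\<^sub>v w" if "j < m" for j
  proof -
    have "col H j \<in> set (cols H)"
      using that H by (auto simp: cols_def)
    then have "col H j \<in> span (set (cols H))"
      using in_own_span cols by auto
    then show ?thesis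
      using mult by (auto simp: module_vec_def)
  qed
  then obtain c where c: "\<And>j. j < m \<Longrightarrow> col H j = c j \<cdot>\<^sub>v w"
    by metis
  have "H $$ (i, j) = w $ i * c j" if "i < n" "j < m" for i j
  proof -
    have "H $$ (i, j) = col H j $ i"
      using that H by simp
    then show ?thesis
      using c[OF that(2)] that(1) w by simp
  qed
  then show ?thesis
    using that[of "\<lambda>i. w $ i" c] by blast
qed

text \<open>The product form bounds the rank above by 1; column \<open>j\<close> is nonzero, hence
  independent, and bounds it below.\<close>

lemma rank_product_entries_eq_1:
  fixes H :: "'a :: field mat"
  assumes H: "H \<in> carrier_mat n m"
    and prod: "\<And>i j. i < n \<Longrightarrow> j < m \<Longrightarrow> H $$ (i, j) = b i * c j"
    and nz: "i < n" "j < m" "b i \<noteq> 0" "c j \<noteq> 0"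
  shows "vec_space.rank n H = 1"
proof -
  interpret vec_space "TYPE('a)" n .
  have le: "rank H \<le> 1"
    using rank_le_1_product_entries[OF H, of b c] prod H by auto
  have "col H j \<in> set (cols H)"
    using nz H by (auto simp: cols_def)
  moreover have "col H j \<noteq> 0\<^sub>v n"
  proof
    assume "col H j = 0\<^sub>v n"
    then have "col H j $ i = 0"
      using nz by simp
    then show False
      using prod nz H by simp
  qed
  then have "lin_indpt {col H j}"
    using lin_indpt_singleton[of "col H j"] H by auto
  ultimately have "card {col H j} \<le> rank H"
    using rank_ge_card_indpt[OF H] by blast
  with le show ?thesis
    by simp
qed

section \<open>Linear relations and prescribed values\<close>

text \<open>Solve for the term of largest index with nonzero coefficient. This serves both the
  existence and the minimality of the minimal polynomial of a row.\<close>

lemma leading_relation: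
  fixes \<phi> :: "nat \<Rightarrow> nat \<Rightarrow> real"
  assumes "\<And>i. i < n \<Longrightarrow> (\<Sum>j<N. x j * \<phi> j i) = 0" and "j < N" "x j \<noteq> 0"
  obtains k a where "k < N" "\<And>i. i < n \<Longrightarrow> \<phi> k i = (\<Sum>j<k. a j * \<phi> j i)"
proof -
  define k where "k = Max {j. j < N \<and> x j \<noteq> 0}"
  have fin: "finite {j. j < N \<and> x j \<noteq> 0}"
    by simp
  have "k \<in> {j. j < N \<and> x j \<noteq> 0}"
    unfolding k_def using assms(2,3) by (intro Max_in) auto
  then have k: "k < N" "x k \<noteq> 0"
    by auto
  have above: "x j = 0" if "k < j" "j < N" for j
    using Max_ge[OF fin, of j] that unfolding k_def by fastforce
  have "\<phi> k i = (\<Sum>j<k. (- x j / x k) * \<phi> j i)" if "i < n" for i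
  proof -
    have "0 = (\<Sum>j<Suc k. x j * \<phi> j i)"
      unfolding assms(1)[OF that, symmetric]
      by (rule sum.mono_neutral_right) (use k above in \<open>auto simp: not_less_eq\<close>)
    then have "x k * \<phi> k i = - (\<Sum>j<k. x j * \<phi> j i)"
      by simp
    then have "\<phi> k i = - (\<Sum>j<k. x j * \<phi> j i) / x k"
      using k(2) by (simp add: field_simps)
    then show ?thesis
      by (simp add: sum_divide_distrib sum_negf)
  qed
  with k(1) show ?thesis
    by (rule that)
qed

text \<open>\<open>Suc n\<close> vectors in dimension \<open>n\<close> are dependent. A zero row
  \<open>n\<close> is added to make the matrix square, so that a determinant can be used.\<close>

lemma nontrivial_relation:
  fixes \<phi> :: "nat \<Rightarrow> nat \<Rightarrow> real"
  obtains x where "\<And>i. i < n \<Longrightarrow> (\<Sum>j<Suc n. x j * \<phi> j i) = 0" "\<exists>j<Suc n. x j \<noteq> 0"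
proof -
  let ?M = "mat (Suc n) (Suc n) (\<lambda>(i, j). if i < n then \<phi> j i else 0)"
  have M: "?M \<in> carrier_mat (Suc n) (Suc n)"
    by simp
  \<comment> \<open>The product is the added row \<open>n\<close> of \<open>?M\<close>, which is
    zero.\<close>
  have "?M\<^sup>T *\<^sub>v unit_vec (Suc n) n = 0\<^sub>v (Suc n)"
    by (rule eq_vecI) auto
  moreover have "unit_vec (Suc n) n \<noteq> (0\<^sub>v (Suc n) :: real vec)"
    by simp
  moreover have MT: "?M\<^sup>T \<in> carrier_mat (Suc n) (Suc n)"
    by (simp only: transpose_carrier_mat M)
  ultimately have "det ?M\<^sup>T = 0"
    unfolding det_0_iff_vec_prod_zero_field[OF MT] using unit_vec_carrier by blast
  then have "det ?M = 0"
    using det_transpose[OF M] by simp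
  then obtain v where v: "v \<in> carrier_vec (Suc n)" "v \<noteq> 0\<^sub>v (Suc n)" "?M *\<^sub>v v = 0\<^sub>v (Suc n)"
    using det_0_iff_vec_prod_zero_field[OF M] by blast
  have "(\<Sum>j<Suc n. v $ j * \<phi> j i) = 0" if "i < n" for i
  proof -
    have "(?M *\<^sub>v v) $ i = 0"
      using v(3) that by simp
    then show ?thesis
      using that v(1) by (simp add: scalar_prod_def atLeast0LessThan mult.commute)
  qed
  moreover have "\<exists>j<Suc n. v $ j \<noteq> 0"
    using v(1,2) by (metis carrier_vecD eq_vecI index_zero_vec)
  ultimately show ?thesis
    using that by blast
qed

lemma prescribed_values:
  fixes \<phi> :: "nat \<Rightarrow> nat \<Rightarrow> real"
  assumes indep: "\<And>x j. (\<And>i. i < n \<Longrightarrow> (\<Sum>j<m. x j * \<phi> j i) = 0) \<Longrightarrow> j < m \<Longrightarrow> x j = 0"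
  obtains b where "\<And>j. j < m \<Longrightarrow> (\<Sum>i<n. \<phi> j i * b i) = d j"
proof -
  \<comment> \<open>Independence makes the Gram matrix \<open>G\<close> invertible; \<open>b\<close> is found in the span of the \<open>\<phi> j\<close>.\<close>
  let ?G = "mat m m (\<lambda>(j, l). \<Sum>i<n. \<phi> j i * \<phi> l i)"
  have G: "?G \<in> carrier_mat m m"
    by simp
  have app: "(?G *\<^sub>v x) $ j = (\<Sum>i<n. \<phi> j i * (\<Sum>l<m. x $ l * \<phi> l i))"
    if "x \<in> carrier_vec m" "j < m" for x j
  proof -
    have "(?G *\<^sub>v x) $ j = (\<Sum>l<m. \<Sum>i<n. \<phi> j i * \<phi> l i * x $ l)"
      using that by (simp add: scalar_prod_def atLeast0LessThan sum_distrib_right)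
    also have "\<dots> = (\<Sum>i<n. \<Sum>l<m. \<phi> j i * \<phi> l i * x $ l)"
      by (rule sum.swap)
    finally show ?thesis
      by (simp add: sum_distrib_left mult_ac)
  qed
  have "det ?G \<noteq> 0"
  proof
    assume "det ?G = 0"
    then obtain x where x: "x \<in> carrier_vec m" "x \<noteq> 0\<^sub>v m" "?G *\<^sub>v x = 0\<^sub>v m"
      using det_0_iff_vec_prod_zero_field[OF G] by blast
    define s where "s i = (\<Sum>l<m. x $ l * \<phi> l i)" for i
    \<comment> \<open>The squared length of \<open>s\<close> equals the quadratic form of
      \<open>?G\<close> at \<open>x\<close>, so \<open>s = 0\<close>, a relation among the
      \<open>\<phi> j\<close>.\<close>
    have "(\<Sum>i<n. s i * s i) = (\<Sum>i<n. \<Sum>j<m. x $ j * (\<phi> j i * s i))"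
      by (rule sum.cong[OF refl], subst (1) s_def) (simp add: sum_distrib_left mult_ac)
    also have "\<dots> = (\<Sum>j<m. x $ j * (\<Sum>i<n. \<phi> j i * s i))"
      by (subst sum.swap) (simp add: sum_distrib_left)
    also have "\<dots> = (\<Sum>j<m. x $ j * (?G *\<^sub>v x) $ j)"
      using app[OF x(1)] by (simp add: s_def)
    also have "\<dots> = 0"
      unfolding x(3) by simp
    finally have "\<forall>i\<in>{..<n}. s i * s i = 0"
      by (subst (asm) sum_nonneg_eq_0_iff) auto
    then have s0: "(\<Sum>l<m. x $ l * \<phi> l i) = 0" if "i < n" for i
      using that by (simp add: s_def)
    have "x $ j = 0" if "j < m" for j
      by (rule indep[where x = "\<lambda>j. x $ j", OF s0 that])
    then show False
      using x(1,2) by (metis carrier_vecD eq_vecI index_zero_vec)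
  qed
  then have "?G \<in> Units (ring_mat TYPE(real) m ())"
    by (rule det_non_zero_imp_unit[OF G])
  then obtain G' where G': "G' \<in> carrier_mat m m" "?G * G' = 1\<^sub>m m"
    unfolding Units_def ring_mat_def by auto
  let ?y = "G' *\<^sub>v vec m d"
  have "?G *\<^sub>v ?y = vec m d"
    using G' G assoc_mult_mat_vec[OF G G'(1), of "vec m d"] by simp
  moreover have "?y \<in> carrier_vec m"
    using G' by simp
  ultimately have "(\<Sum>i<n. \<phi> j i * (\<Sum>l<m. ?y $ l * \<phi> l i)) = d j" if "j < m" for j
    using app[of ?y j] that by simp
  then show ?thesis
    by (rule that)
qed

section \<open>Polynomial identities and the high-gain estimate\<close>

text \<open>The coefficient of \<open>z ^ l\<close> on the left is \<open>d (m - 1 - l)\<close> plus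
  terms in earlier \<open>d i\<close>, because \<open>\<mu> m = 1\<close>. The system is triangular
  with unit diagonal, so it is solvable for every \<open>g\<close>.\<close>

lemma triangular_coefficients:
  fixes \<mu> g :: "nat \<Rightarrow> real"
  assumes "\<mu> m = 1"
  shows "\<exists>d :: nat \<Rightarrow> real. \<forall>z :: complex.
    (\<Sum>j\<le>m. of_real (\<mu> j) * (\<Sum>i<j. of_real (d i) * z ^ (j - Suc i))) = (\<Sum>l<m. of_real (g l) * z ^ l)"
  using assms
proof (induction m arbitrary: \<mu> g)
  case 0
  then show ?case by simp
next
  case (Suc m)
  from Suc.IH[of "\<lambda>j. \<mu> (Suc j)" "\<lambda>l. g (Suc l)"] Suc.prems
  obtain d where d: "\<And>z :: complex.
    (\<Sum>j\<le>m. of_real (\<mu> (Suc j)) * (\<Sum>i<j. of_real (d i) * z ^ (j - Suc i))) =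
    (\<Sum>l<m. of_real (g (Suc l)) * z ^ l)"
    by auto
  \<comment> \<open>Only the constant term remains to be matched. The new entry at \<open>m\<close>
    enters nothing else, as the sums in \<open>d\<close> use indices below \<open>m\<close>.\<close>
  define e where "e = d(m := g 0 - (\<Sum>j<m. \<mu> (Suc j) * d j))"
  have const: "(\<Sum>j\<le>m. \<mu> (Suc j) * e j) = g 0"
    using Suc.prems by (simp add: e_def lessThan_Suc_atMost[symmetric])
  have "(\<Sum>j\<le>Suc m. of_real (\<mu> j) * (\<Sum>i<j. of_real (e i) * z ^ (j - Suc i))) =
      (\<Sum>l<Suc m. of_real (g l) * z ^ l)" for z :: complex
  proof -
    have inner: "(\<Sum>i<Suc j. of_real (e i) * z ^ (Suc j - Suc i)) =
        z * (\<Sum>i<j. of_real (d i) * z ^ (j - Suc i)) + of_real (e j)" if "j \<le> m" for j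
    proof -
      have "(\<Sum>i<j. of_real (e i) * z ^ (j - i)) = (\<Sum>i<j. z * (of_real (d i) * z ^ (j - Suc i)))"
      proof (rule sum.cong)
        fix i assume "i \<in> {..<j}"
        then have "i < j" by simp
        then have "z ^ (j - i) = z * z ^ (j - Suc i)"
          by (metis Suc_diff_Suc power_Suc)
        then show "of_real (e i) * z ^ (j - i) = z * (of_real (d i) * z ^ (j - Suc i))"
          using \<open>i < j\<close> that by (simp add: e_def)
      qed simp
      then show ?thesis
        by (simp add: sum_distrib_left)
    qed
    have "(\<Sum>j\<le>Suc m. of_real (\<mu> j) * (\<Sum>i<j. of_real (e i) * z ^ (j - Suc i))) =
        (\<Sum>j\<le>m. of_real (\<mu> (Suc j)) * (\<Sum>i<Suc j. of_real (e i) * z ^ (Suc j - Suc i)))"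
      by (subst sum.atMost_Suc_shift) (simp del: sum.lessThan_Suc)
    also have "\<dots> = (\<Sum>j\<le>m. z * (of_real (\<mu> (Suc j)) * (\<Sum>i<j. of_real (d i) * z ^ (j - Suc i)))
        + of_real (\<mu> (Suc j) * e j))"
      by (rule sum.cong) (simp_all only: inner atMost_iff distrib_left of_real_mult mult_ac)
    also have "\<dots> = z * (\<Sum>l<m. of_real (g (Suc l)) * z ^ l) + of_real (g 0)"
      by (simp only: sum.distrib sum_distrib_left[symmetric] d of_real_sum[symmetric] const)
    also have "\<dots> = (\<Sum>l<Suc m. of_real (g l) * z ^ l)"
      by (subst sum.lessThan_Suc_shift) (simp add: sum_distrib_left mult_ac)
    finally show ?thesis .
  qed
  then show ?case by blast
qed

lemma high_gain:
  fixes \<mu> :: "nat \<Rightarrow> real"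
  assumes "\<mu> (Suc p) = 1"
  obtains K :: real where "K > 0"
    "\<And>k z. k \<ge> K \<Longrightarrow> Re z \<ge> 0 \<Longrightarrow>
      (\<Sum>j\<le>Suc p. of_real (\<mu> j) * z ^ j) + of_real k * (z + 1) ^ p \<noteq> 0"
proof
  \<comment> \<open>Coefficients of \<open>\<mu>\<close> minus \<open>(z + 1) ^ Suc p\<close>. Both
    are monic, so the difference has degree at most \<open>p\<close>, and \<open>C\<close> bounds it
    by \<open>C * norm w ^ p\<close> on the closed right half-plane.\<close>
  define e where "e j = \<mu> j - real (Suc p choose j)" for j
  define C where "C = (\<Sum>j\<le>p. \<bar>e j\<bar>)"
  have "C \<ge> 0"
    unfolding C_def by (rule sum_nonneg) simp
  then show "C + 1 > 0"
    by simp
  fix k :: real and z :: complex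
  assume k: "k \<ge> C + 1" and z: "Re z \<ge> 0"
  define w where "w = z + 1"
  define r where "r = (\<Sum>j\<le>p. of_real (e j) * z ^ j)"
  have w1: "norm w \<ge> 1"
    using complex_Re_le_cmod[of w] z unfolding w_def by simp
  have zw: "norm z \<le> norm w"
    using z unfolding w_def cmod_def by (auto intro!: real_sqrt_le_mono power_mono)
  have "w ^ Suc p = (\<Sum>j\<le>Suc p. of_nat (Suc p choose j) * z ^ j)"
    unfolding w_def by (subst binomial_ring) simp
  then have split: "(\<Sum>j\<le>Suc p. of_real (\<mu> j) * z ^ j) = w ^ Suc p + r"
    using assms by (simp add: r_def e_def algebra_simps sum_subtractf)
  have "norm r \<le> (\<Sum>j\<le>p. \<bar>e j\<bar> * norm w ^ p)"
    unfolding r_def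
  proof (rule sum_norm_le)
    fix j assume "j \<in> {..p}"
    have "norm z ^ j \<le> norm w ^ j"
      using zw by (intro power_mono) auto
    also have "\<dots> \<le> norm w ^ p"
      using w1 \<open>j \<in> {..p}\<close> by (intro power_increasing) auto
    finally show "norm (of_real (e j) * z ^ j) \<le> \<bar>e j\<bar> * norm w ^ p"
      by (simp add: norm_mult norm_power mult_left_mono)
  qed
  then have r: "norm r \<le> C * norm w ^ p"
    by (simp add: C_def sum_distrib_right)
  show "(\<Sum>j\<le>Suc p. of_real (\<mu> j) * z ^ j) + of_real k * (z + 1) ^ p \<noteq> 0"
  proof
    assume "(\<Sum>j\<le>Suc p. of_real (\<mu> j) * z ^ j) + of_real k * (z + 1) ^ p = 0"
    then have "w ^ p * (w + of_real k) = - r"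
      unfolding split w_def[symmetric] by (simp add: algebra_simps eq_neg_iff_add_eq_0)
    then have "norm w ^ p * norm (w + of_real k) = norm r"
      by (metis norm_minus_cancel norm_mult norm_power)
    with r have "norm w ^ p * norm (w + of_real k) \<le> norm w ^ p * C"
      by (simp add: mult.commute)
    moreover have "norm w ^ p > 0"
      using w1 by (intro zero_less_power) linarith
    ultimately have "norm (w + of_real k) \<le> C"
      by simp
    \<comment> \<open>The real part of \<open>w + k\<close> is at least \<open>1 + k\<close>, which
      exceeds \<open>C\<close>.\<close>
    then show False
      using complex_Re_le_cmod[of "w + of_real k"] z k by (simp add: w_def)
  qed
qed

section \<open>Stabilising rank-one perturbations\<close>

text \<open>Take \<open>c\<close> on the moment curve \<open>(1, t, t^2, ...)\<close>: its pairing
  with \<open>v\<close> is a nonzero polynomial in \<open>t\<close>, so finitely many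
  \<open>v\<close> exclude only finitely many real \<open>t\<close>.\<close>

lemma real_vec_nonorthogonal:
  fixes Z :: "complex vec set"
  assumes "finite Z" and "\<And>v. v \<in> Z \<Longrightarrow> v \<in> carrier_vec n \<and> v \<noteq> 0\<^sub>v n"
  obtains c :: "nat \<Rightarrow> real" where "c 0 = 1" "\<And>v. v \<in> Z \<Longrightarrow> (\<Sum>i<n. of_real (c i) * v $ i) \<noteq> 0"
proof -
  define P where "P v = (\<Sum>i<n. monom (v $ i) i)" for v :: "complex vec"
  have coeff: "coeff (P v) i = v $ i" if "i < n" for v i
    using that by (simp add: P_def coeff_sum)
  have "P v \<noteq> 0" if "v \<in> Z" for v
  proof
    assume "P v = 0"
    then have "v $ i = 0" if "i < n" for i
      using coeff[OF that, of v] by simp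
    then show False
      using assms(2)[OF that] by (metis carrier_vecD eq_vecI index_zero_vec)
  qed
  then have "finite (\<Union>v\<in>Z. of_real -` {x :: complex. poly (P v) x = 0} :: real set)"
    using assms(1) by (intro finite_UN_I finite_vimageI poly_roots_finite) (auto simp: inj_on_def)
  then obtain t :: real where t: "t \<notin> (\<Union>v\<in>Z. of_real -` {x :: complex. poly (P v) x = 0})"
    using ex_new_if_finite[OF infinite_UNIV_char_0] by blast
  have "(\<Sum>i<n. of_real (t ^ i) * v $ i) \<noteq> 0" if "v \<in> Z" for v
  proof -
    have "poly (P v) (of_real t) \<noteq> 0"
      using t that by blast
    then show ?thesis
      by (simp add: P_def poly_sum poly_monom mult.commute)
  qed
  then show ?thesis
    using that[of "\<lambda>i. t ^ i"] by simp
qed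

lemma eigenvector_cmat_iff:
  assumes "A \<in> carrier_mat n n"
  shows "eigenvector (cmat A) v z \<longleftrightarrow> v \<in> carrier_vec n \<and> v \<noteq> 0\<^sub>v n \<and>
    (\<forall>i<n. (\<Sum>l<n. of_real (A $$ (i, l)) * v $ l) = z * v $ i)"
proof (cases "v \<in> carrier_vec n")
  case True
  then have "cmat A *\<^sub>v v = z \<cdot>\<^sub>v v \<longleftrightarrow>
      (\<forall>i<n. (\<Sum>l<n. of_real (A $$ (i, l)) * v $ l) = z * v $ i)"
    using assms by (auto simp: vec_eq_iff scalar_prod_def atLeast0LessThan)
  then show ?thesis
    using assms True by (simp add: eigenvector_def)
qed (use assms in \<open>simp add: eigenvector_def\<close>)

text \<open>The perturbation sees \<open>v\<close> only through the scalar
  \<open>c\<^sup>T v\<close>; vectors with value 0 are left alone.\<close>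

lemma rank_one_perturbation_sum:
  assumes "F \<in> carrier_mat n n" "H \<in> carrier_mat n n"
    and "\<And>i j. i < n \<Longrightarrow> j < n \<Longrightarrow> H $$ (i, j) = b i * c j" and "i < n"
  shows "(\<Sum>l<n. of_real ((F + \<alpha> \<cdot>\<^sub>m H) $$ (i, l)) * v $ l) =
    (\<Sum>l<n. of_real (F $$ (i, l)) * v $ l) + of_real (\<alpha> * b i) * (\<Sum>l<n. of_real (c l) * (v $ l :: complex))"
proof -
  have "(\<Sum>l<n. of_real ((F + \<alpha> \<cdot>\<^sub>m H) $$ (i, l)) * v $ l) =
      (\<Sum>l<n. of_real (F $$ (i, l)) * v $ l + of_real (\<alpha> * b i) * (of_real (c l) * v $ l))"
    using assms by (intro sum.cong) (auto simp: algebra_simps)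
  then show ?thesis
    by (simp add: sum.distrib sum_distrib_left)
qed

section \<open>Necessity of one block per unstable eigenvalue\<close>

lemma stabilizable_imp_one_block:
  assumes F: "F \<in> carrier_mat n n" and H: "H \<in> carrier_mat n n"
    and rank: "vec_space.rank n H = 1" and stable: "hurwitz_stable (F + \<alpha> \<cdot>\<^sub>m H)"
    and unstable: "unstable_eigenvalue F z"
  shows "only_one_jordan_block (cmat F) z"
proof -
  obtain b c where bc: "\<And>i j. i < n \<Longrightarrow> j < n \<Longrightarrow> H $$ (i, j) = b i * c j"
    using rank_1_product_entries[OF H rank] by blast
  have FH: "F + \<alpha> \<cdot>\<^sub>m H \<in> carrier_mat n n"
    using F H by simp
  define s where "s v = (\<Sum>l<n. of_real (c l) * (v $ l :: complex))" for v
  note pert = rank_one_perturbation_sum[OF F H bc, folded s_def]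
  have s_nz: "s u \<noteq> 0" if u: "eigenvector (cmat F) u z" for u
  proof
    assume "s u = 0"
    then have "eigenvector (cmat (F + \<alpha> \<cdot>\<^sub>m H)) u z"
      using u pert unfolding eigenvector_cmat_iff[OF F] eigenvector_cmat_iff[OF FH] by simp
    then show False
      using stable unstable
      unfolding hurwitz_stable_def unstable_eigenvalue_def eigenvalue_def by force
  qed
  obtain v where v: "eigenvector (cmat F) v z"
    using unstable unfolding unstable_eigenvalue_def eigenvalue_def by blast
  have "\<exists>a. u = a \<cdot>\<^sub>v v" if u: "eigenvector (cmat F) u z" for u
  proof -
    \<comment> \<open>The combination of \<open>u\<close> and \<open>v\<close> killed by
      \<open>s\<close>. It satisfies the eigenvalue equation, so \<open>s_nz\<close> forces it to
      vanish.\<close>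
    define x where "x = s v \<cdot>\<^sub>v u - s u \<cdot>\<^sub>v v"
    have carr: "u \<in> carrier_vec n" "v \<in> carrier_vec n"
      using u v unfolding eigenvector_cmat_iff[OF F] by auto
    then have x: "x \<in> carrier_vec n"
      unfolding x_def by simp
    have x_idx: "x $ l = s v * u $ l - s u * v $ l" if "l < n" for l
      using that carr by (simp add: x_def)
    have lin: "(\<Sum>l<n. f l * x $ l) = s v * (\<Sum>l<n. f l * u $ l) - s u * (\<Sum>l<n. f l * v $ l)"
      for f :: "nat \<Rightarrow> complex"
      by (simp add: x_idx sum_distrib_left sum_subtractf algebra_simps)
    have "s x = 0"
      unfolding s_def[of x] lin by (simp add: s_def mult.commute)
    moreover have "\<forall>i<n. (\<Sum>l<n. of_real (F $$ (i, l)) * x $ l) = z * x $ i"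
      using u v unfolding eigenvector_cmat_iff[OF F] lin by (simp add: x_idx algebra_simps)
    ultimately have "x = 0\<^sub>v n"
      using s_nz[of x] x unfolding eigenvector_cmat_iff[OF F] by blast
    then have "s v * u $ l = s u * v $ l" if "l < n" for l
      using x_idx[OF that] that by simp
    then have "u = (s u / s v) \<cdot>\<^sub>v v"
      using carr s_nz[OF v] by (intro eq_vecI) (auto simp: field_simps)
    then show ?thesis by blast
  qed
  then show ?thesis
    using only_one_jordan_block_iff_multiples[of "cmat F" n z] F v by auto
qed

section \<open>Sufficiency: construction of the stabilising matrix\<close>

lemma one_block_imp_stabilizable:
  assumes n: "n \<ge> 1" and F: "F \<in> carrier_mat n n"
    and one: "\<And>z. unstable_eigenvalue F z \<Longrightarrow> only_one_jordan_block (cmat F) z"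
  obtains H K where "H \<in> carrier_mat n n" "vec_space.rank n H = 1" "K > 0"
    "\<And>\<alpha>. \<alpha> \<le> - K \<Longrightarrow> hurwitz_stable (F + \<alpha> \<cdot>\<^sub>m H)"
proof -
  let ?U = "{z. unstable_eigenvalue F z}"
  have cF: "cmat F \<in> carrier_mat n n"
    using F by simp
  have "finite ?U"
    using card_finite_spectrum(1)[OF cF] by (rule rev_finite_subset)
      (auto simp: spectrum_def unstable_eigenvalue_def)
  have "\<forall>z. \<exists>v. unstable_eigenvalue F z \<longrightarrow>
      eigenvector (cmat F) v z \<and> (\<forall>u. eigenvector (cmat F) u z \<longrightarrow> (\<exists>a. u = a \<cdot>\<^sub>v v))"
    using one only_one_jordan_block_iff_multiples[OF cF] by blast
  then obtain w where w: "\<And>z. unstable_eigenvalue F z \<Longrightarrow> eigenvector (cmat F) (w z) z"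
    and mult: "\<And>z u. unstable_eigenvalue F z \<Longrightarrow> eigenvector (cmat F) u z \<Longrightarrow> \<exists>a. u = a \<cdot>\<^sub>v w z"
    by metis
  obtain c :: "nat \<Rightarrow> real" where c0: "c 0 = 1"
    and c: "\<And>v. v \<in> w ` ?U \<Longrightarrow> (\<Sum>i<n. of_real (c i) * v $ i) \<noteq> 0"
    by (rule real_vec_nonorthogonal[of "w ` ?U" n])
      (use \<open>finite ?U\<close> w in \<open>auto simp: eigenvector_cmat_iff[OF F]\<close>)
  \<comment> \<open>The Hautus test for detectability of the pair \<open>(c, F)\<close>.\<close>
  have observable: "(\<Sum>i<n. of_real (c i) * u $ i) \<noteq> 0"
    if u: "eigenvector (cmat F) u z" and z: "Re z \<ge> 0" for u z
  proof -
    have uz: "unstable_eigenvalue F z"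
      using u z unfolding unstable_eigenvalue_def eigenvalue_def by blast
    obtain a where a: "u = a \<cdot>\<^sub>v w z"
      using mult[OF uz u] by blast
    have wz: "w z \<in> carrier_vec n"
      using w[OF uz] unfolding eigenvector_cmat_iff[OF F] by simp
    have "a \<noteq> 0"
      using u wz unfolding eigenvector_cmat_iff[OF F] a by auto
    moreover have "(\<Sum>i<n. of_real (c i) * u $ i) = a * (\<Sum>i<n. of_real (c i) * w z $ i)"
      using wz by (simp add: a sum_distrib_left mult_ac)
    ultimately show ?thesis
      using c[of "w z"] uz by simp
  qed
  \<comment> \<open>\<open>\<phi> j\<close> is the row vector \<open>c F^j\<close>.\<close>
  define \<phi> where "\<phi> j = ((\<lambda>f i. \<Sum>l<n. f l * F $$ (l, i)) ^^ j) c" for j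
  have \<phi>0: "\<phi> 0 = c" and \<phi>_Suc: "\<And>j i. \<phi> (Suc j) i = (\<Sum>l<n. \<phi> j l * F $$ (l, i))"
    by (simp_all add: \<phi>_def)
  define rel where "rel k a \<longleftrightarrow> (\<forall>i<n. \<phi> k i = (\<Sum>j<k. a j * \<phi> j i))" for k a
  \<comment> \<open>The degree of the minimal polynomial of the row \<open>c\<close> under
    \<open>F\<close>. It is positive because \<open>c 0 = 1\<close>.\<close>
  define m where "m = (LEAST k. \<exists>a. rel k a)"
  have "\<exists>k a. rel k a"
  proof -
    obtain x where x: "\<And>i. i < n \<Longrightarrow> (\<Sum>j<Suc n. x j * \<phi> j i) = 0" "\<exists>j<Suc n. x j \<noteq> 0"
      using nontrivial_relation by blast
    then obtain j where j: "j < Suc n" "x j \<noteq> 0" by blast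
    obtain k a where "\<And>i. i < n \<Longrightarrow> \<phi> k i = (\<Sum>j<k. a j * \<phi> j i)"
      by (rule leading_relation[where x = x, OF x(1) j]) blast+
    then show ?thesis
      unfolding rel_def by blast
  qed
  then have "\<exists>a. rel m a"
    unfolding m_def by (rule LeastI_ex)
  then obtain a where a: "rel m a" by blast
  have "m \<noteq> 0"
  proof
    assume "m = 0"
    then have "c 0 = 0"
      using a n by (simp add: rel_def \<phi>0)
    then show False using c0 by simp
  qed
  then obtain p where p: "m = Suc p"
    using not0_implies_Suc by blast
  \<comment> \<open>The leading term of a nontrivial relation among the first \<open>m\<close> rows
    would contradict the minimality of \<open>m\<close>.\<close>
  have indep: "x j = 0" if sum_0: "\<And>i. i < n \<Longrightarrow> (\<Sum>j<m. x j * \<phi> j i) = 0" and j: "j < m" for x j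
  proof (rule ccontr)
    assume xj: "x j \<noteq> 0"
    obtain k b where k: "k < m" and "\<And>i. i < n \<Longrightarrow> \<phi> k i = (\<Sum>j<k. b j * \<phi> j i)"
      by (rule leading_relation[where x = x, OF sum_0 j xj]) blast+
    then have "rel k b"
      unfolding rel_def by blast
    with k show False
      using not_less_Least unfolding m_def by blast
  qed
  define \<mu> where "\<mu> j = (if j = m then 1 else - a j)" for j
  have \<mu>m: "\<mu> m = 1"
    by (simp add: \<mu>_def)
  have \<mu>: "(\<Sum>j\<le>m. \<mu> j * \<phi> j i) = 0" if "i < n" for i
    using a that by (simp add: lessThan_Suc_atMost[symmetric] \<mu>_def rel_def sum_negf)
  \<comment> \<open>The \<open>d j\<close> are the Markov parameters \<open>c F^j b\<close> to be
    realised. With them the transfer function from \<open>b\<close> to \<open>c\<close> has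
    numerator \<open>(z + 1) ^ p\<close>, whose roots are stable, over the denominator
    \<open>\<mu>\<close>.\<close>
  obtain d where d: "\<And>z :: complex.
      (\<Sum>j\<le>m. of_real (\<mu> j) * (\<Sum>i<j. of_real (d i) * z ^ (j - Suc i))) =
      (\<Sum>l<m. of_real (real (p choose l)) * z ^ l)"
    using triangular_coefficients[of \<mu> m "\<lambda>l. real (p choose l)"] \<mu>m by blast
  have q: "(\<Sum>j\<le>m. of_real (\<mu> j) * (\<Sum>i<j. of_real (d i) * z ^ (j - Suc i))) = (z + 1) ^ p"
    for z :: complex
    unfolding d unfolding p lessThan_Suc_atMost by (subst binomial_ring) simp
  obtain b where b: "\<And>j. j < m \<Longrightarrow> (\<Sum>i<n. \<phi> j i * b i) = d j"
    by (rule prescribed_values[where n = n and m = m and \<phi> = \<phi> and d = d]) (use indep in \<open>blast+\<close>)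
  \<comment> \<open>If \<open>b\<close> vanished, so would all \<open>d j\<close>, but the numerator
    has value 1 at \<open>z = 0\<close>. This gives \<open>H\<close> rank 1.\<close>
  have "\<exists>i<n. b i \<noteq> 0"
  proof (rule ccontr)
    assume "\<not> (\<exists>i<n. b i \<noteq> 0)"
    then have "d j = 0" if "j < m" for j
      using b[OF that] by simp
    then have "(\<Sum>j\<le>m. of_real (\<mu> j) * (\<Sum>i<j. of_real (d i) * 0 ^ (j - Suc i))) = (0 :: complex)"
      by (intro sum.neutral) auto
    then show False
      unfolding q by simp
  qed
  then obtain i0 where i0: "i0 < n" "b i0 \<noteq> 0" by blast
  define H where "H = mat n n (\<lambda>(i, j). b i * c j)"
  have H: "H \<in> carrier_mat n n" and H_idx: "\<And>i j. i < n \<Longrightarrow> j < n \<Longrightarrow> H $$ (i, j) = b i * c j"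
    by (simp_all add: H_def)
  have rank: "vec_space.rank n H = 1"
    using rank_product_entries_eq_1[OF H H_idx, of i0 0] i0 c0 n by simp
  obtain K where K: "K > 0" "\<And>k z. k \<ge> K \<Longrightarrow> Re z \<ge> 0 \<Longrightarrow>
      (\<Sum>j\<le>m. of_real (\<mu> j) * z ^ j) + of_real k * (z + 1) ^ p \<noteq> 0"
    using high_gain[of \<mu> p] \<mu>m unfolding p by blast
  have "hurwitz_stable (F + \<alpha> \<cdot>\<^sub>m H)" if \<alpha>: "\<alpha> \<le> - K" for \<alpha>
    unfolding hurwitz_stable_def
  proof (intro allI impI)
    fix z assume "eigenvalue (cmat (F + \<alpha> \<cdot>\<^sub>m H)) z"
    then obtain v where v: "eigenvector (cmat (F + \<alpha> \<cdot>\<^sub>m H)) v z"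
      unfolding eigenvalue_def by blast
    have FH: "F + \<alpha> \<cdot>\<^sub>m H \<in> carrier_mat n n"
      using F H by simp
    \<comment> \<open>\<open>y j\<close> is \<open>c F^j v\<close>. Applying the row
      \<open>c F^j\<close> to \<open>F v = z v - \<alpha> (c v) b\<close> gives the recursion
      \<open>y_Suc\<close>, valid while \<open>d j\<close> is prescribed, that is for
      \<open>j < m\<close>.\<close>
    define y where "y j = (\<Sum>i<n. of_real (\<phi> j i) * v $ i)" for j
    have Fv: "(\<Sum>l<n. of_real (F $$ (i, l)) * v $ l) = z * v $ i - of_real (\<alpha> * b i) * y 0"
      if "i < n" for i
      using v rank_one_perturbation_sum[OF F H H_idx that, of \<alpha> v] that
      unfolding eigenvector_cmat_iff[OF FH] y_def \<phi>0 by (simp add: algebra_simps)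
    have y_Suc: "y (Suc j) = z * y j - of_real (\<alpha> * d j) * y 0" if "j < m" for j
    proof -
      have "y (Suc j) = (\<Sum>i<n. \<Sum>l<n. of_real (\<phi> j l) * (of_real (F $$ (l, i)) * v $ i))"
        by (simp add: y_def \<phi>_Suc sum_distrib_right mult.assoc)
      also have "\<dots> = (\<Sum>l<n. of_real (\<phi> j l) * (\<Sum>i<n. of_real (F $$ (l, i)) * v $ i))"
        by (subst sum.swap) (simp add: sum_distrib_left)
      also have "\<dots> = (\<Sum>l<n. z * (of_real (\<phi> j l) * v $ l) - of_real \<alpha> * y 0 * of_real (\<phi> j l * b l))"
        by (rule sum.cong[OF refl], subst Fv) (simp_all add: algebra_simps)
      also have "\<dots> = z * y j - of_real \<alpha> * y 0 * of_real (\<Sum>l<n. \<phi> j l * b l)"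
        by (simp add: sum_subtractf sum_distrib_left y_def)
      finally show ?thesis
        unfolding b[OF that] by (simp add: mult_ac)
    qed
    have y: "y j = y 0 * (z ^ j + of_real (- \<alpha>) * (\<Sum>i<j. of_real (d i) * z ^ (j - Suc i)))"
      if "j \<le> m" for j
      using that
    proof (induction j)
      case (Suc j)
      have "(\<Sum>i<j. of_real (d i) * z ^ (j - i)) = z * (\<Sum>i<j. of_real (d i) * z ^ (j - Suc i))"
        unfolding sum_distrib_left
      proof (rule sum.cong[OF refl])
        fix i assume "i \<in> {..<j}"
        then have "z ^ (j - i) = z * z ^ (j - Suc i)"
          by (metis Suc_diff_Suc lessThan_iff power_Suc)
        then show "of_real (d i) * z ^ (j - i) = z * (of_real (d i) * z ^ (j - Suc i))"
          by simp
      qed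
      moreover have "y (Suc j) = z * y j - of_real (\<alpha> * d j) * y 0"
        using Suc.prems by (intro y_Suc) simp
      moreover have "y j = y 0 * (z ^ j + of_real (- \<alpha>) * (\<Sum>i<j. of_real (d i) * z ^ (j - Suc i)))"
        using Suc by simp
      ultimately show ?case
        by (simp only: sum.lessThan_Suc diff_Suc_Suc diff_self_eq_0) (simp add: algebra_simps)
    qed simp
    \<comment> \<open>The weights \<open>\<mu> j\<close> annihilate the rows, so the sum is 0;
      inserting the closed form of \<open>y j\<close> factors it as \<open>y 0\<close> times the
      polynomial of \<open>high_gain\<close> with gain \<open>- \<alpha>\<close>.\<close>
    have "(\<Sum>j\<le>m. of_real (\<mu> j) * y j) = (\<Sum>i<n. of_real (\<Sum>j\<le>m. \<mu> j * \<phi> j i) * v $ i)"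
      unfolding y_def sum_distrib_left of_real_sum sum_distrib_right
      by (subst sum.swap) (simp add: mult_ac)
    then have "0 = (\<Sum>j\<le>m. of_real (\<mu> j) * y j)"
      using \<mu> by simp
    also have "\<dots> = (\<Sum>j\<le>m. y 0 * (of_real (\<mu> j) * z ^ j + of_real (- \<alpha>) *
        (of_real (\<mu> j) * (\<Sum>i<j. of_real (d i) * z ^ (j - Suc i)))))"
      by (rule sum.cong[OF refl], subst y) (auto simp: algebra_simps)
    also have "\<dots> = y 0 * ((\<Sum>j\<le>m. of_real (\<mu> j) * z ^ j) + of_real (- \<alpha>) * (z + 1) ^ p)"
      by (simp only: sum_distrib_left[symmetric] sum.distrib q)
    finally have "y 0 = 0 \<or> (\<Sum>j\<le>m. of_real (\<mu> j) * z ^ j) + of_real (- \<alpha>) * (z + 1) ^ p = 0"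
      by auto
    then show "Re z < 0"
    proof
      \<comment> \<open>The perturbation then does not act on \<open>v\<close>, an eigenvector of
        \<open>F\<close> killed by \<open>c\<close>, so \<open>observable\<close> excludes
        \<open>Re z \<ge> 0\<close>.\<close>
      assume y0: "y 0 = 0"
      then have "eigenvector (cmat F) v z"
        using v Fv unfolding eigenvector_cmat_iff[OF F] eigenvector_cmat_iff[OF FH] by simp
      then show ?thesis
        using observable[of v z] y0 by (auto simp: y_def \<phi>0 not_less[symmetric])
    next
      assume "(\<Sum>j\<le>m. of_real (\<mu> j) * z ^ j) + of_real (- \<alpha>) * (z + 1) ^ p = 0"
      then show ?thesis
        using K(2)[of "- \<alpha>" z] \<alpha> by force
    qed
  qed
  then show ?thesis
    using that H rank K(1) by blast
qed

text \<open>For \<open>n = 0\<close> the equivalence fails: there are no eigenvalues at all, yet no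
  \<open>H\<close> has rank 1.\<close>

theorem theorem1:
  fixes F :: "real mat" and n :: nat
  assumes "n \<ge> 1" and "F \<in> carrier_mat n n"
  shows "(\<exists>H \<in> carrier_mat n n. vec_space.rank n H = 1 \<and>
            (\<exists>\<alpha>\<^sub>1 < 0. {..\<alpha>\<^sub>1} \<subseteq> stability_region F H))
         \<longleftrightarrow> (\<forall>z. unstable_eigenvalue F z \<longrightarrow> only_one_jordan_block (cmat F) z)"
proof
  assume "\<exists>H \<in> carrier_mat n n. vec_space.rank n H = 1 \<and>
    (\<exists>\<alpha>\<^sub>1 < 0. {..\<alpha>\<^sub>1} \<subseteq> stability_region F H)"
  then obtain H \<alpha> where "H \<in> carrier_mat n n" "vec_space.rank n H = 1"
    "{..\<alpha>} \<subseteq> stability_region F H"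
    by blast
  then show "\<forall>z. unstable_eigenvalue F z \<longrightarrow> only_one_jordan_block (cmat F) z"
    using stabilizable_imp_one_block[OF assms(2)] unfolding stability_region_def by blast
next
  assume "\<forall>z. unstable_eigenvalue F z \<longrightarrow> only_one_jordan_block (cmat F) z"
  then obtain H K where "H \<in> carrier_mat n n" "vec_space.rank n H = 1" "K > 0"
    and "\<And>\<alpha>. \<alpha> \<le> - K \<Longrightarrow> hurwitz_stable (F + \<alpha> \<cdot>\<^sub>m H)"
    using one_block_imp_stabilizable[OF assms] by blast
  then show "\<exists>H \<in> carrier_mat n n. vec_space.rank n H = 1 \<and>
      (\<exists>\<alpha>\<^sub>1 < 0. {..\<alpha>\<^sub>1} \<subseteq> stability_region F H)"
    unfolding stability_region_def
    by (intro bexI[of _ H] conjI exI[of _ "- K"]) auto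
qed

end
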